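(* Let $Z^*$ be the set of cluster points of the sequence $\{z^k\}_{k\in\mathbb N}$, $z^k=(\overline{x}^k,x^k,L^k,\xi^k)$, generated by the inexact MBA algorithm described in the context. Consider any $\overline z=(\overline x,\overline s,\overline L,\overline\xi)\in Z^*$. Suppose that $g$ is twice continuously differentiable at $\overline x$ and that the function $$h(x,\omega,\xi):=f(x)+\phi(x)+\delta_{\mathbb{R}_-^m}(\omega)+\langle x,\xi\rangle+\psi^*(-\xi),\qquad (x,\omega,\xi)\in\mathbb{R}^n\times\mathbb{R}^m\times\mathbb{R}^n,$$ has the KL property of exponent $q\in[1/2,1)$ at $(\overline x,g(\overline x),\overline\xi)$. Then the function $\Phi$ has the KL property of exponent $q$ at $\overline z$ under the condition $${\rm Ker}[\mathcal{I}\ \ \nabla g(\overline x)]\cap\big[\mathbb{R}^n\times\mathcal{N}_{\mathbb{R}_-^m}(g(\overline x))\big]=\{(0_{\mathbb{R}^n},0_{\mathbb{R}^m})\},$$ where $[\mathcal{I}\ \ \nabla g(\overline x)]$ denotes the linear map $(a,\lambda)\mapsto a+\nabla g(\overline x)\lambda$ from $\mathbb{R}^n\times\mathbb{R}^m$ to $\mathbb{R}^n$.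
   Context: Problem and standing assumptions. Consider $\min_{x\in\mathbb{R}^n}F(x):=f(x)+\phi(x)-\psi(x)+\delta_{\mathbb{R}_-^m}(g(x))$, where $\delta_C$ is the indicator function of $C$ and: (i) $g:\mathbb{R}^n\to\mathbb{R}^m$ is $\mathcal{C}^{1,1}$ (differentiable with locally Lipschitz derivative) and $\Gamma:=g^{-1}(\mathbb{R}_-^m)\neq\emptyset$; (ii) $f:\mathbb{R}^n\to(-\infty,\infty]$ is proper lsc and $\mathcal{C}^{1,1}$ on an open convex set $\mathcal{O}\supset\Gamma$; (iii) $\phi,\psi:\mathbb{R}^n\to\mathbb{R}$ are convex; (iv) $\inf_{\Gamma}F>-\infty$. $\partial$ denotes the limiting subdifferential, $\mathcal{N}_C$ the limiting normal cone, $\nabla g(x):=g'(x)^\top$, $t_+=\max\{0,t\}$ (componentwise for vectors), $\psi^*$ the conjugate of $\psi$. Algorithm (inexact MBA). Let $G(x,s,L):=g(s)+g'(s)(x-s)+\frac12\|x-s\|^2L$ for $x,s\in\mathbb{R}^n$, $L\in\mathbb{R}^m_{++}$. Input: $0<\mu_{\min}\le\mu_{\max}$, $0<L_{\min}\le L_{\max}$, $M,\beta_R,\beta_F,\alpha>0$, $\tau>1$, $x^0\in\Gamma$. For $k=0,1,2,\ldots$: choose $\xi^k\in\partial(-\psi)(x^k)$, $\mu_{k,0}\in[\mu_{\min},\mu_{\max}]$, $L^{k,0}\in\mathbb{R}^m$ with entries in $[L_{\min},L_{\max}]$. Inner loop, $j=0,1,2,\ldots$: choose a self-adjoint linear $\mathcal{Q}_{k,j}:\mathbb{R}^n\to\mathbb{R}^n$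 with $\mu_{k,j}\mathcal{I}\preceq\mathcal{Q}_{k,j}\preceq(\mu_{k,j}+M)\mathcal{I}$; put $\vartheta_{k,j}(x):=f(x^k)-\psi(x^k)+\langle\nabla f(x^k)+\xi^k,x-x^k\rangle+\frac12\langle x-x^k,\mathcal{Q}_{k,j}(x-x^k)\rangle$, $F_{k,j}:=\vartheta_{k,j}+\phi$, $\Gamma_{k,j}:=\{x: G(x,x^k,L^{k,j})\le0\}$, and let $\overline{x}^{k,j}$ be the unique minimizer of $F_{k,j}$ on $\Gamma_{k,j}$. Find $y^{k,j}\in\mathbb{R}^n$, $v^{k,j}\in\partial\phi(y^{k,j})$, $\lambda^{k,j}\in\mathbb{R}^m_+$ with $R_{k,j}(y^{k,j},v^{k,j},\lambda^{k,j})\le\frac{\beta_R}{2}\|y^{k,j}-x^k\|^2$, $F_{k,j}(y^{k,j})\le F_{k,j}(x^k)$ and $F_{k,j}(y^{k,j})-F_{k,j}(\overline{x}^{k,j})\le\frac{\beta_F}{2}\|y^{k,j}-x^k\|^2$, where, with $r:=\nabla\vartheta_{k,j}(x)+v+\nabla_xG(x,x^k,L^{k,j})\lambda$, $R_{k,j}(x,v,\lambda):=(\langle x,r\rangle)_++(-\langle\lambda,G(x,x^k,L^{k,j})\rangle)_++\|r\|+\|[G(x,x^k,L^{k,j})]_+\|_\infty$. If $g(y^{k,j})\le0$ and $F(y^{k,j})\le F(x^k)-\frac\alpha2\|y^{k,j}-x^k\|^2$, set $j_k:=j$ and leave the inner loop; else if $g(y^{k,j})\not\le0$, set $L^{k,j+1}=\tau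 L^{k,j}$, $\mu_{k,j+1}=\mu_{k,j}$; else set $L^{k,j+1}=L^{k,j}$, $\mu_{k,j+1}=\tau\mu_{k,j}$. After the inner loop set $(\mu_k,L^k,\mathcal{Q}_k,\overline{x}^k):=(\mu_{k,j_k},L^{k,j_k},\mathcal{Q}_{k,j_k},\overline{x}^{k,j_k})$ and $(x^{k+1},v^{k+1},\lambda^{k+1}):=(y^{k,j_k},v^{k,j_k},\lambda^{k,j_k})$. The function $\Phi$. For $z=(x,s,L,\xi)\in\mathbb{Z}:=\mathbb{R}^n\times\mathbb{R}^n\times\mathbb{R}^m_{++}\times\mathbb{R}^n$, $\Phi(z):=f(x)+\phi(x)+\delta_{G^{-1}(\mathbb{R}^m_-)}(x,s,L)+\langle x,\xi\rangle+\psi^*(-\xi)$. KL property of exponent $q\in[0,1)$. A proper function $h$ has the KL property of exponent $q$ at $\overline x\in{\rm dom}\,\partial h$ if there are $\delta>0$, $\eta\in(0,\infty]$, $c>0$ such that, with $\varphi(t)=ct^{1-q}$, $\varphi'(h(x)-h(\overline x))\,{\rm dist}(0,\partial h(x))\ge1$ for all $x$ with $\|x-\overline x\|\le\delta$ and $h(\overline x)<h(x)<h(\overline x)+\eta$. *)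

theory Defs
  imports "HOL-Analysis.Analysis"
begin

section \<open>Variational analysis\<close>

definition proper :: "('a \<Rightarrow> ereal) \<Rightarrow> bool" where
  "proper h \<longleftrightarrow> (\<forall>x. h x \<noteq> -\<infinity>) \<and> (\<exists>x. h x < \<infinity>)"

definition lsc :: "('a::topological_space \<Rightarrow> ereal) \<Rightarrow> bool" where
  "lsc h \<longleftrightarrow> (\<forall>x. h x \<le> Liminf (at x) h)"

definition ind :: "'a set \<Rightarrow> 'a \<Rightarrow> ereal" where
  "ind C x = (if x \<in> C then 0 else \<infinity>)"

definition conjugate :: "('a::real_inner \<Rightarrow> real) \<Rightarrow> 'a \<Rightarrow> ereal" where
  "conjugate \<psi> \<zeta> = (SUP x. ereal (\<zeta> \<bullet> x - \<psi> x))"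

definition regular_subdiff :: "('a::real_inner \<Rightarrow> ereal) \<Rightarrow> 'a \<Rightarrow> 'a set" where
  "regular_subdiff h x = {v. \<bar>h x\<bar> \<noteq> \<infinity> \<and>
     0 \<le> Liminf (at x) (\<lambda>y. (h y - h x - ereal (v \<bullet> (y - x))) / ereal (norm (y - x)))}"

definition limiting_subdiff :: "('a::real_inner \<Rightarrow> ereal) \<Rightarrow> 'a \<Rightarrow> 'a set" where
  "limiting_subdiff h x = {v. \<bar>h x\<bar> \<noteq> \<infinity> \<and>
     (\<exists>X V. (\<forall>k. V k \<in> regular_subdiff h (X k)) \<and>
        X \<longlonglongrightarrow> x \<and> (\<lambda>k. h (X k)) \<longlonglongrightarrow> h x \<and> V \<longlonglongrightarrow> v)}"

definition regular_normal_cone :: "'a::real_inner set \<Rightarrow> 'a \<Rightarrow> 'a set" where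
  "regular_normal_cone C x = {v. x \<in> C \<and>
     Limsup (at x within C) (\<lambda>y. ereal (v \<bullet> (y - x) / norm (y - x))) \<le> 0}"

definition limiting_normal_cone :: "'a::real_inner set \<Rightarrow> 'a \<Rightarrow> 'a set" where
  "limiting_normal_cone C x = {v. x \<in> C \<and>
     (\<exists>X V. (\<forall>k. V k \<in> regular_normal_cone C (X k)) \<and> X \<longlonglongrightarrow> x \<and> V \<longlonglongrightarrow> v)}"

text \<open>Unlike \<^const>\<open>infdist\<close>, the distance to the empty set is \<open>\<infinity>\<close>, so points without
  limiting subgradients impose no condition in the KL inequality below.\<close>

definition ext_dist :: "'a::metric_space \<Rightarrow> 'a set \<Rightarrow> ereal" where
  "ext_dist x S = (INF y\<in>S. ereal (dist x y))"

definition KL_property :: "('a::real_inner \<Rightarrow> ereal) \<Rightarrow> real \<Rightarrow> 'a \<Rightarrow> bool" where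
  "KL_property h q xbar \<longleftrightarrow>
     proper h \<and> 0 \<le> q \<and> q < 1 \<and> limiting_subdiff h xbar \<noteq> {} \<and>
     (\<exists>\<delta>>0. \<exists>\<eta>::ereal. \<eta> > 0 \<and> (\<exists>c>0. \<forall>x.
        norm (x - xbar) \<le> \<delta> \<and> h xbar < h x \<and> h x < h xbar + \<eta> \<longrightarrow>
        1 \<le> ereal (deriv (\<lambda>t::real. c * t powr (1 - q)) (real_of_ereal (h x - h xbar)))
              * ext_dist 0 (limiting_subdiff h x)))"

definition cluster_points :: "(nat \<Rightarrow> 'a::topological_space) \<Rightarrow> 'a set" where
  "cluster_points z = {l. \<exists>r::nat \<Rightarrow> nat. strict_mono r \<and> (z \<circ> r) \<longlonglongrightarrow> l}"


section \<open>Differentiability\<close>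

definition gradient :: "('a::real_inner \<Rightarrow> real) \<Rightarrow> 'a \<Rightarrow> 'a" where
  "gradient u x = (THE D. GDERIV u x :> D)"

text \<open>The transposed derivative \<open>\<nabla>g(x) = g'(x)\<^sup>T\<close> of a vector-valued map.\<close>

definition nabla :: "('a::euclidean_space \<Rightarrow> 'b::euclidean_space) \<Rightarrow> 'a \<Rightarrow> 'b \<Rightarrow> 'a" where
  "nabla g x = adjoint (frechet_derivative g (at x))"

definition C11_on :: "'a::real_normed_vector set \<Rightarrow> ('a \<Rightarrow> 'b::real_normed_vector) \<Rightarrow> bool" where
  "C11_on S u \<longleftrightarrow> (\<exists>u' :: 'a \<Rightarrow> 'a \<Rightarrow>\<^sub>L 'b.
     (\<forall>x\<in>S. (u has_derivative blinfun_apply (u' x)) (at x)) \<and>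
     (\<forall>x\<in>S. \<exists>e>0. \<exists>K. K-lipschitz_on (ball x e \<inter> S) u'))"

text \<open>Twice differentiable near \<open>x\<close>, with second derivative continuous at \<open>x\<close>.  Being
  \<open>C\<^sup>2\<close> on a neighbourhood of \<open>x\<close> is a stronger requirement.\<close>

definition C2_at :: "('a::real_normed_vector \<Rightarrow> 'b::real_normed_vector) \<Rightarrow> 'a \<Rightarrow> bool" where
  "C2_at u x \<longleftrightarrow> (\<exists>U (u' :: 'a \<Rightarrow> 'a \<Rightarrow>\<^sub>L 'b) (u'' :: 'a \<Rightarrow> 'a \<Rightarrow>\<^sub>L ('a \<Rightarrow>\<^sub>L 'b)).
     open U \<and> x \<in> U \<and>
     (\<forall>y\<in>U. (u has_derivative blinfun_apply (u' y)) (at y)) \<and>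
     (\<forall>y\<in>U. (u' has_derivative blinfun_apply (u'' y)) (at y)) \<and>
     isCont u'' x)"


section \<open>The constrained DC program\<close>

text \<open>The order on \<^typ>\<open>real^'m\<close> is componentwise, so \<open>{..0}\<close> is the nonpositive orthant.  Its
  strict part \<open><\<close> is not componentwise, whence the explicit quantifier for the positive
  orthant.\<close>

definition objective ::
    "(real^'n \<Rightarrow> ereal) \<Rightarrow> (real^'n \<Rightarrow> real) \<Rightarrow> (real^'n \<Rightarrow> real) \<Rightarrow> (real^'n \<Rightarrow> real^'m)
     \<Rightarrow> real^'n \<Rightarrow> ereal" where
  "objective f \<phi> \<psi> g x = f x + ereal (\<phi> x) - ereal (\<psi> x) + ind {..0} (g x)"

definition dc_program ::
    "(real^'n \<Rightarrow> ereal) \<Rightarrow> (real^'n \<Rightarrow> real) \<Rightarrow> (real^'n \<Rightarrow> real) \<Rightarrow> (real^'n \<Rightarrow> real^'m)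
     \<Rightarrow> (real^'n) set \<Rightarrow> bool" where
  "dc_program f \<phi> \<psi> g U \<longleftrightarrow>
     C11_on UNIV g \<and> g -` {..0} \<noteq> {} \<and>
     proper f \<and> lsc f \<and>
     open U \<and> convex U \<and> g -` {..0} \<subseteq> U \<and>
     (\<forall>x\<in>U. \<bar>f x\<bar> \<noteq> \<infinity>) \<and> C11_on U (\<lambda>x. real_of_ereal (f x)) \<and>
     convex_on UNIV \<phi> \<and> convex_on UNIV \<psi> \<and>
     (INF x\<in>g -` {..0}. objective f \<phi> \<psi> g x) > -\<infinity>"

definition mba_G :: "(real^'n \<Rightarrow> real^'m) \<Rightarrow> real^'n \<Rightarrow> real^'n \<Rightarrow> real^'m \<Rightarrow> real^'m" where
  "mba_G g x s L = g s + frechet_derivative g (at s) (x - s) + ((norm (x - s))\<^sup>2 / 2) *\<^sub>R L"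

text \<open>\<open>\<Phi>\<close> is a function on \<open>\<real>\<^sup>n \<times> \<real>\<^sup>n \<times> \<real>\<^sup>m\<^sub>+\<^sub>+ \<times> \<real>\<^sup>n\<close>, which is open; it is extended
  by \<open>\<infinity>\<close>, and this does not affect subdifferentials or the KL property at its points.\<close>

definition mba_Phi ::
    "(real^'n \<Rightarrow> ereal) \<Rightarrow> (real^'n \<Rightarrow> real) \<Rightarrow> (real^'n \<Rightarrow> real) \<Rightarrow> (real^'n \<Rightarrow> real^'m)
     \<Rightarrow> (real^'n) \<times> (real^'n) \<times> (real^'m) \<times> (real^'n) \<Rightarrow> ereal" where
  "mba_Phi f \<phi> \<psi> g = (\<lambda>(x, s, L, \<xi>).
     if \<forall>i. 0 < L $ i
     then f x + ereal (\<phi> x) + ind {..0} (mba_G g x s L) + ereal (x \<bullet> \<xi>) + conjugate \<psi> (- \<xi>)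
     else \<infinity>)"

definition mba_h ::
    "(real^'n \<Rightarrow> ereal) \<Rightarrow> (real^'n \<Rightarrow> real) \<Rightarrow> (real^'n \<Rightarrow> real)
     \<Rightarrow> (real^'n) \<times> (real^'m) \<times> (real^'n) \<Rightarrow> ereal" where
  "mba_h f \<phi> \<psi> = (\<lambda>(x, w, \<xi>).
     f x + ereal (\<phi> x) + ind {..0} w + ereal (x \<bullet> \<xi>) + conjugate \<psi> (- \<xi>))"


section \<open>The inexact moving balls approximation algorithm\<close>

definition mba_theta ::
    "(real^'n \<Rightarrow> ereal) \<Rightarrow> (real^'n \<Rightarrow> real) \<Rightarrow> real^'n \<Rightarrow> real^'n \<Rightarrow> (real^'n \<Rightarrow> real^'n)
     \<Rightarrow> real^'n \<Rightarrow> real" where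
  "mba_theta f \<psi> xk \<xi> Q x =
     real_of_ereal (f xk) - \<psi> xk
     + (gradient (\<lambda>u. real_of_ereal (f u)) xk + \<xi>) \<bullet> (x - xk)
     + ((x - xk) \<bullet> Q (x - xk)) / 2"

definition mba_model ::
    "(real^'n \<Rightarrow> ereal) \<Rightarrow> (real^'n \<Rightarrow> real) \<Rightarrow> (real^'n \<Rightarrow> real) \<Rightarrow> real^'n \<Rightarrow> real^'n
     \<Rightarrow> (real^'n \<Rightarrow> real^'n) \<Rightarrow> real^'n \<Rightarrow> real" where
  "mba_model f \<phi> \<psi> xk \<xi> Q x = mba_theta f \<psi> xk \<xi> Q x + \<phi> x"

definition mba_residual ::
    "(real^'n \<Rightarrow> ereal) \<Rightarrow> (real^'n \<Rightarrow> real) \<Rightarrow> (real^'n \<Rightarrow> real^'m) \<Rightarrow> real^'n \<Rightarrow> real^'n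
     \<Rightarrow> (real^'n \<Rightarrow> real^'n) \<Rightarrow> real^'m \<Rightarrow> real^'n \<Rightarrow> real^'n \<Rightarrow> real^'m \<Rightarrow> real" where
  "mba_residual f \<psi> g xk \<xi> Q L x v lam =
     (let r = gradient (mba_theta f \<psi> xk \<xi> Q) x + v + nabla (\<lambda>u. mba_G g u xk L) x lam
      in max 0 (x \<bullet> r) + max 0 (- (lam \<bullet> mba_G g x xk L)) + norm r
         + infnorm (\<chi> i. max 0 (mba_G g x xk L $ i)))"

text \<open>The linear map \<open>Q\<close> is self-adjoint with \<open>a I \<preceq> Q \<preceq> b I\<close> in the Loewner order.\<close>

definition selfadjoint_between :: "real \<Rightarrow> real \<Rightarrow> (real^'n \<Rightarrow> real^'n) \<Rightarrow> bool" where
  "selfadjoint_between a b Q \<longleftrightarrow>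
     linear Q \<and> (\<forall>u w. Q u \<bullet> w = u \<bullet> Q w) \<and>
     (\<forall>u. a * (u \<bullet> u) \<le> u \<bullet> Q u \<and> u \<bullet> Q u \<le> b * (u \<bullet> u))"

definition mba_trial ::
    "(real^'n \<Rightarrow> ereal) \<Rightarrow> (real^'n \<Rightarrow> real) \<Rightarrow> (real^'n \<Rightarrow> real) \<Rightarrow> (real^'n \<Rightarrow> real^'m)
     \<Rightarrow> real \<Rightarrow> real \<Rightarrow> real^'n \<Rightarrow> real^'n \<Rightarrow> (real^'n \<Rightarrow> real^'n) \<Rightarrow> real^'m
     \<Rightarrow> real^'n \<Rightarrow> real^'n \<Rightarrow> real^'n \<Rightarrow> real^'m \<Rightarrow> bool" where
  "mba_trial f \<phi> \<psi> g \<beta>R \<beta>F xk \<xi> Q L xbar y v lam \<longleftrightarrow>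
     is_arg_min (mba_model f \<phi> \<psi> xk \<xi> Q) (\<lambda>x. mba_G g x xk L \<le> 0) xbar \<and>
     v \<in> limiting_subdiff (\<lambda>x. ereal (\<phi> x)) y \<and> 0 \<le> lam \<and>
     mba_residual f \<psi> g xk \<xi> Q L y v lam \<le> \<beta>R / 2 * (norm (y - xk))\<^sup>2 \<and>
     mba_model f \<phi> \<psi> xk \<xi> Q y \<le> mba_model f \<phi> \<psi> xk \<xi> Q xk \<and>
     mba_model f \<phi> \<psi> xk \<xi> Q y - mba_model f \<phi> \<psi> xk \<xi> Q xbar \<le> \<beta>F / 2 * (norm (y - xk))\<^sup>2"

definition mba_descent ::
    "(real^'n \<Rightarrow> ereal) \<Rightarrow> (real^'n \<Rightarrow> real) \<Rightarrow> (real^'n \<Rightarrow> real) \<Rightarrow> (real^'n \<Rightarrow> real^'m)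
     \<Rightarrow> real \<Rightarrow> real^'n \<Rightarrow> real^'n \<Rightarrow> bool" where
  "mba_descent f \<phi> \<psi> g \<alpha> xk y \<longleftrightarrow>
     objective f \<phi> \<psi> g y \<le> objective f \<phi> \<psi> g xk - ereal (\<alpha> / 2 * (norm (y - xk))\<^sup>2)"

text \<open>A complete run: outer iterates \<open>x k\<close>, and inner data indexed by \<open>k\<close> and \<open>j\<close>, of which only
  \<open>j \<le> jk k\<close> is relevant, \<open>jk k\<close> being the index at which the inner loop of iteration \<open>k\<close> stops.\<close>

definition inexact_MBA ::
    "(real^'n \<Rightarrow> ereal) \<Rightarrow> (real^'n \<Rightarrow> real) \<Rightarrow> (real^'n \<Rightarrow> real) \<Rightarrow> (real^'n \<Rightarrow> real^'m)
     \<Rightarrow> real \<Rightarrow> real \<Rightarrow> real \<Rightarrow> real \<Rightarrow> real \<Rightarrow> real \<Rightarrow> real \<Rightarrow> real \<Rightarrow> real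
     \<Rightarrow> (nat \<Rightarrow> real^'n) \<Rightarrow> (nat \<Rightarrow> real^'n)
     \<Rightarrow> (nat \<Rightarrow> nat \<Rightarrow> real) \<Rightarrow> (nat \<Rightarrow> nat \<Rightarrow> real^'m) \<Rightarrow> (nat \<Rightarrow> nat \<Rightarrow> real^'n \<Rightarrow> real^'n)
     \<Rightarrow> (nat \<Rightarrow> nat \<Rightarrow> real^'n) \<Rightarrow> (nat \<Rightarrow> nat \<Rightarrow> real^'n) \<Rightarrow> (nat \<Rightarrow> nat \<Rightarrow> real^'n)
     \<Rightarrow> (nat \<Rightarrow> nat \<Rightarrow> real^'m) \<Rightarrow> (nat \<Rightarrow> nat) \<Rightarrow> bool" where
  "inexact_MBA f \<phi> \<psi> g \<mu>min \<mu>max Lmin Lmax M \<beta>R \<beta>F \<alpha> \<tau> x \<xi> \<mu> L Q xbar y v lam jk \<longleftrightarrow>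
     0 < \<mu>min \<and> \<mu>min \<le> \<mu>max \<and> 0 < Lmin \<and> Lmin \<le> Lmax \<and>
     0 < M \<and> 0 < \<beta>R \<and> 0 < \<beta>F \<and> 0 < \<alpha> \<and> 1 < \<tau> \<and>
     x 0 \<in> g -` {..0} \<and>
     (\<forall>k.
        \<xi> k \<in> limiting_subdiff (\<lambda>u. ereal (- \<psi> u)) (x k) \<and>
        \<mu> k 0 \<in> {\<mu>min..\<mu>max} \<and> (\<forall>i. L k 0 $ i \<in> {Lmin..Lmax}) \<and>
        (\<forall>j \<le> jk k.
           selfadjoint_between (\<mu> k j) (\<mu> k j + M) (Q k j) \<and>
           mba_trial f \<phi> \<psi> g \<beta>R \<beta>F (x k) (\<xi> k) (Q k j) (L k j)
             (xbar k j) (y k j) (v k j) (lam k j)) \<and>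
        (\<forall>j < jk k.
           \<not> (g (y k j) \<le> 0 \<and> mba_descent f \<phi> \<psi> g \<alpha> (x k) (y k j)) \<and>
           (if \<not> g (y k j) \<le> 0
            then L k (Suc j) = \<tau> *\<^sub>R L k j \<and> \<mu> k (Suc j) = \<mu> k j
            else L k (Suc j) = L k j \<and> \<mu> k (Suc j) = \<tau> * \<mu> k j)) \<and>
        g (y k (jk k)) \<le> 0 \<and> mba_descent f \<phi> \<psi> g \<alpha> (x k) (y k (jk k)) \<and>
        x (Suc k) = y k (jk k))"

end

theory Submission
  imports Defs
begin

text \<open>The kernel condition leaves the first component free, so it forces
  \<open>\<N>\<^bsub>\<real>\<^sub>-\<^sup>m\<^esub>(g(x))\<close> to be trivial at the limit \<open>x\<close>, that is, \<open>g(x) < 0\<close> componentwise.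
  Sufficient decrease and the strong convexity of the subproblems force the two limits \<open>x\<close> and
  \<open>s\<close> to coincide, so \<open>G(x, s, L) = g(x) < 0\<close> at the cluster point.  By continuity both indicator
  terms vanish locally, and there \<open>\<Phi>\<close> and \<open>h\<close> are the same function of \<open>(x, \<xi>)\<close>
  composed with coordinate projections, under which the KL property is invariant.\<close>

section \<open>Subdifferentials and the KL property under projections\<close>

text \<open>Multiplying by \<open>norm (y - x)\<close>, positive off \<open>x\<close>, removes the
  extended-real quotient from the \<open>Liminf\<close>. What remains is an eventual affine minorant
  with error \<open>e * norm (y - x)\<close>, a form that transports easily under maps.\<close>

lemma regular_subdiff_iff:
  fixes h :: "'a::real_inner \<Rightarrow> ereal"
  shows "v \<in> regular_subdiff h x \<longleftrightarrow> \<bar>h x\<bar> \<noteq> \<infinity> \<and>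
    (\<forall>e>0. \<forall>\<^sub>F y in at x. h x + ereal (v \<bullet> (y - x) - e * norm (y - x)) \<le> h y)"
    (is "_ \<longleftrightarrow> _ \<and> ?R")
proof (cases "\<bar>h x\<bar> = \<infinity>")
  case True
  then show ?thesis by (simp add: regular_subdiff_def)
next
  case False
  then obtain r where r: "h x = ereal r" by auto
  let ?q = "\<lambda>y. (h y - h x - ereal (v \<bullet> (y - x))) / ereal (norm (y - x))"
  have lt: "ereal (- e) < ?q y \<longleftrightarrow> h x + ereal (v \<bullet> (y - x) - e * norm (y - x)) < h y"
    if "y \<noteq> x" for e y
  proof -
    have n: "norm (y - x) > 0" using that by simp
    show ?thesis
    proof (cases "h y")
      case (real s)
      have "- e < (s - r - v \<bullet> (y - x)) / norm (y - x) \<longleftrightarrow>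
          r + (v \<bullet> (y - x) - e * norm (y - x)) < s"
        using n by (simp add: field_simps)
      then show ?thesis using n by (simp add: real r)
    qed (use n r in auto)
  qed
  have "0 \<le> Liminf (at x) ?q \<longleftrightarrow> (\<forall>c<0. \<forall>\<^sub>F y in at x. c < ?q y)"
    by (rule le_Liminf_iff)
  also have "\<dots> \<longleftrightarrow> (\<forall>e>0. \<forall>\<^sub>F y in at x. ereal (- e) < ?q y)"
  proof safe
    fix e :: real
    assume "\<forall>c<0. \<forall>\<^sub>F y in at x. c < ?q y" "0 < e"
    then show "\<forall>\<^sub>F y in at x. ereal (- e) < ?q y" by auto
  next
    fix c :: ereal
    assume *: "\<forall>e>0. \<forall>\<^sub>F y in at x. ereal (- e) < ?q y" and "c < 0"
    \<comment> \<open>The bound \<open>c\<close> may be \<open>-\<infinity>\<close>; density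
      supplies a real number between \<open>c\<close> and 0, so real errors suffice.\<close>
    then obtain t where t: "c < ereal t" "ereal t < 0"
      using ereal_dense2 by blast
    then have "\<forall>\<^sub>F y in at x. ereal (- (- t)) < ?q y" using * by (intro *[rule_format]) auto
    then show "\<forall>\<^sub>F y in at x. c < ?q y"
      by eventually_elim (use t(1) in \<open>auto intro: less_trans\<close>)
  qed
  also have "\<dots> \<longleftrightarrow>
      (\<forall>e>0. \<forall>\<^sub>F y in at x. h x + ereal (v \<bullet> (y - x) - e * norm (y - x)) < h y)"
    using lt by (intro all_cong eventually_cong refl) (auto simp: eventually_at_filter)
  also have "\<dots> \<longleftrightarrow> ?R"
  proof safe
    fix e :: real
    assume "\<forall>e>0. \<forall>\<^sub>F y in at x. h x + ereal (v \<bullet> (y - x) - e * norm (y - x)) < h y" "0 < e"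
    then have "\<forall>\<^sub>F y in at x. h x + ereal (v \<bullet> (y - x) - e * norm (y - x)) < h y" by blast
    then show "\<forall>\<^sub>F y in at x. h x + ereal (v \<bullet> (y - x) - e * norm (y - x)) \<le> h y"
      by eventually_elim simp
  next
    fix e :: real
    assume *: ?R and e: "0 < e"
    \<comment> \<open>Halving the error leaves a strict gap off \<open>x\<close>, because
      \<open>h x\<close> is finite; this recovers the strict inequality.\<close>
    then have "\<forall>\<^sub>F y in at x. h x + ereal (v \<bullet> (y - x) - e / 2 * norm (y - x)) \<le> h y"
      using *[rule_format, of "e / 2"] e by argo
    moreover have "\<forall>\<^sub>F y in at x. y \<noteq> x" by (simp add: eventually_at_filter)
    ultimately show "\<forall>\<^sub>F y in at x. h x + ereal (v \<bullet> (y - x) - e * norm (y - x)) < h y"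
    proof eventually_elim
      case (elim y)
      then have "e / 2 * norm (y - x) < e * norm (y - x)" using e by simp
      then have "h x + ereal (v \<bullet> (y - x) - e * norm (y - x))
          < h x + ereal (v \<bullet> (y - x) - e / 2 * norm (y - x))"
        by (simp add: r)
      then show ?case using elim(1) by (rule less_le_trans)
    qed
  qed
  finally show ?thesis using False by (simp add: regular_subdiff_def)
qed

text \<open>At \<open>y = x\<close> the inequality is trivial, so the punctured filter can be filled
  in. A projection may send points other than \<open>z\<close> to the image of \<open>z\<close>, and
  full neighbourhood filters still pull back along it.\<close>

lemma regular_subdiff_iff_nhds:
  fixes h :: "'a::real_inner \<Rightarrow> ereal"
  shows "v \<in> regular_subdiff h x \<longleftrightarrow> \<bar>h x\<bar> \<noteq> \<infinity> \<and>
    (\<forall>e>0. \<forall>\<^sub>F y in nhds x. h x + ereal (v \<bullet> (y - x) - e * norm (y - x)) \<le> h y)"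
  unfolding regular_subdiff_iff by (simp add: eventually_nhds_conv_at)

text \<open>\<open>E\<close> is the Hilbert-space adjoint of \<open>P\<close>, and being a right
  inverse as well makes it an isometric embedding. The intended case is a coordinate projection,
  whose adjoint pads with zeros.\<close>

locale coisometry =
  fixes P :: "'a::real_inner \<Rightarrow> 'b::real_inner" and E :: "'b \<Rightarrow> 'a"
  assumes P: "bounded_linear P" and E: "bounded_linear E"
    and P_E [simp]: "P (E u) = u"
    and inner_E: "E u \<bullet> z = u \<bullet> P z"
begin

sublocale P: bounded_linear P by (rule P)
sublocale E: bounded_linear E by (rule E)

lemma norm_E [simp]: "norm (E u) = norm u"
  by (simp add: norm_eq_sqrt_inner inner_E)

lemma norm_P_le: "norm (P z) \<le> norm z"
proof -
  have "(norm (P z))\<^sup>2 = E (P z) \<bullet> z" by (simp add: inner_E power2_norm_eq_inner)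
  also have "\<dots> \<le> norm (P z) * norm z" using norm_cauchy_schwarz[of "E (P z)" z] by simp
  finally show ?thesis by (auto simp: power2_eq_square mult_le_cancel_left)
qed

text \<open>This affine section of \<open>P\<close> passes through \<open>z\<close> and displaces it
  by exactly \<open>norm (y - P z)\<close>. It lifts neighbourhoods and sequences at
  \<open>P z\<close> to ones at \<open>z\<close>.\<close>

lemma tendsto_lift: "((\<lambda>y. z + E (y - P z)) \<longlongrightarrow> z) (nhds (P z))"
proof -
  have "((\<lambda>y. z + E (y - P z)) \<longlongrightarrow> z + E (P z - P z)) (nhds (P z))"
    by (intro tendsto_intros E.tendsto filterlim_ident)
  then show ?thesis by (simp add: E.zero)
qed

lemma P_lift: "P (z + E (y - P z)) = y"
  by (simp add: P.add)

context
  fixes H :: "'a \<Rightarrow> ereal" and p :: "'b \<Rightarrow> ereal" and N :: "'a set"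
  assumes N: "open N" and H_eq: "\<And>z. z \<in> N \<Longrightarrow> H z = p (P z)"
begin

text \<open>Chain rule with equality. Images under \<open>E\<close> are subgradients because
  \<open>P\<close> is nonexpansive. Conversely, restriction to the affine section yields
  \<open>P w\<close>, and constancy of \<open>H\<close> near \<open>z\<close> along the kernel of
  \<open>P\<close> leaves \<open>w\<close> no component there.\<close>

lemma regular_subdiff_coisometry:
  assumes z: "z \<in> N"
  shows "regular_subdiff H z = E ` regular_subdiff p (P z)"
proof (intro set_eqI iffI)
  fix w
  assume "w \<in> E ` regular_subdiff p (P z)"
  then obtain v where v: "v \<in> regular_subdiff p (P z)" and w: "w = E v" by blast
  have "\<forall>\<^sub>F y in nhds z. H z + ereal (w \<bullet> (y - z) - e * norm (y - z)) \<le> H y" if e: "e > 0" for e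
  proof -
    have "\<forall>\<^sub>F y in nhds (P z). p (P z) + ereal (v \<bullet> (y - P z) - e * norm (y - P z)) \<le> p y"
      using v e unfolding regular_subdiff_iff_nhds by blast
    moreover have "filterlim P (nhds (P z)) (nhds z)"
      by (intro P.tendsto filterlim_ident)
    ultimately have "\<forall>\<^sub>F y in nhds z.
        p (P z) + ereal (v \<bullet> (P y - P z) - e * norm (P y - P z)) \<le> p (P y)"
      by (rule eventually_compose_filterlim)
    moreover have "\<forall>\<^sub>F y in nhds z. y \<in> N" using N z by (rule eventually_nhds_in_open)
    ultimately show ?thesis
    proof eventually_elim
      case (elim y)
      have "w \<bullet> (y - z) - e * norm (y - z) \<le> v \<bullet> (P y - P z) - e * norm (P y - P z)"
        using norm_P_le[of "y - z"] e by (simp add: w inner_E P.diff)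
      then have "H z + ereal (w \<bullet> (y - z) - e * norm (y - z))
          \<le> p (P z) + ereal (v \<bullet> (P y - P z) - e * norm (P y - P z))"
        using H_eq[OF z] by (intro add_mono) auto
      then show ?case using elim H_eq by (metis order_trans)
    qed
  qed
  then show "w \<in> regular_subdiff H z"
    using v H_eq[OF z] by (simp add: regular_subdiff_iff_nhds)
next
  fix w
  assume w: "w \<in> regular_subdiff H z"
  have fin: "\<bar>p (P z)\<bar> \<noteq> \<infinity>" using w H_eq[OF z] by (simp add: regular_subdiff_def)
  have ev: "\<forall>\<^sub>F y in nhds z. p (P z) + ereal (w \<bullet> (y - z) - e * norm (y - z)) \<le> p (P y)"
    if "e > 0" for e
  proof -
    have "\<forall>\<^sub>F y in nhds z. H z + ereal (w \<bullet> (y - z) - e * norm (y - z)) \<le> H y"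
      using w that unfolding regular_subdiff_iff_nhds by blast
    moreover have "\<forall>\<^sub>F y in nhds z. y \<in> N" using N z by (rule eventually_nhds_in_open)
    ultimately show ?thesis
      by eventually_elim (use H_eq z in simp)
  qed
  have "P w \<in> regular_subdiff p (P z)"
    unfolding regular_subdiff_iff_nhds
  proof (intro conjI allI impI fin)
    fix e :: real
    assume "0 < e"
    have "\<forall>\<^sub>F y in nhds (P z). p (P z) + ereal (w \<bullet> (z + E (y - P z) - z)
        - e * norm (z + E (y - P z) - z)) \<le> p (P (z + E (y - P z)))"
      by (rule eventually_compose_filterlim[OF ev[OF \<open>0 < e\<close>] tendsto_lift])
    then show "\<forall>\<^sub>F y in nhds (P z). p (P z) + ereal (P w \<bullet> (y - P z) - e * norm (y - P z)) \<le> p y"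
      unfolding P_lift by (simp add: inner_commute[of w] inner_commute[of "P w"] inner_E)
  qed
  moreover have "w = E (P w)"
  proof -
    \<comment> \<open>\<open>p \<circ> P\<close> is constant along \<open>k \<in> ker P\<close>, so \<open>w \<bullet> k \<le> e * norm k\<close> for every \<open>e > 0\<close>\<close>
    define k where "k = w - E (P w)"
    have Pk: "P k = 0" by (simp add: k_def P.diff)
    have bound: "w \<bullet> k \<le> e * norm k" if e: "e > 0" for e
    proof -
      have "((\<lambda>t. z + t *\<^sub>R k) \<longlongrightarrow> z + 0 *\<^sub>R k) (at_right 0)"
        by (intro tendsto_intros)
      then have "((\<lambda>t. z + t *\<^sub>R k) \<longlongrightarrow> z) (at_right 0)" by simp
      from eventually_compose_filterlim[OF ev[OF e] this]
      have "\<forall>\<^sub>F t in at_right 0. p (P z) +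
          ereal (w \<bullet> (z + t *\<^sub>R k - z) - e * norm (z + t *\<^sub>R k - z)) \<le> p (P (z + t *\<^sub>R k))" .
      moreover have "\<forall>\<^sub>F t in at_right (0::real). 0 < t"
        by (simp add: eventually_at_right_less)
      ultimately have "\<forall>\<^sub>F t in at_right (0::real). w \<bullet> k \<le> e * norm k"
      proof eventually_elim
        case (elim t)
        then have "p (P z) + ereal (t * (w \<bullet> k) - e * (t * norm k)) \<le> p (P z)"
          by (simp add: P.add P.scaleR Pk)
        then have "t * (w \<bullet> k) - e * (t * norm k) \<le> 0"
          using fin by (cases "p (P z)") auto
        then have "t * (w \<bullet> k) \<le> t * (e * norm k)" by (simp add: algebra_simps)
        then show ?case using elim by simp
      qed
      then show ?thesis by simp
    qed
    have "w \<bullet> k \<le> 0 + e" if "e > 0" for e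
    proof -
      \<comment> \<open>Rescaling by \<open>norm k + 1\<close> instead of \<open>norm k\<close> also
        covers \<open>k = 0\<close>.\<close>
      have n: "0 < norm k + 1" by (simp add: add_nonneg_pos)
      have "w \<bullet> k \<le> e / (norm k + 1) * norm k" using that n by (intro bound divide_pos_pos)
      also have "\<dots> \<le> e" using that n by (simp add: pos_divide_le_eq algebra_simps)
      finally show ?thesis by simp
    qed
    then have "w \<bullet> k \<le> 0" by (rule field_le_epsilon)
    \<comment> \<open>\<open>k\<close> is orthogonal to the range of \<open>E\<close>, so
      \<open>w \<bullet> k\<close> equals \<open>k \<bullet> k\<close>.\<close>
    moreover have "E (P w) \<bullet> k = 0" by (simp add: inner_E Pk)
    ultimately have "k \<bullet> k \<le> 0" by (simp add: k_def inner_diff_left)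
    then have "k = 0" using inner_gt_zero_iff[of k] by linarith
    then show ?thesis by (simp add: k_def)
  qed
  ultimately show "w \<in> E ` regular_subdiff p (P z)" by blast
qed

text \<open>The formula for regular subgradients passes to limits: \<open>P\<close> and
  \<open>E\<close> are continuous, the range of \<open>E\<close> is closed, and \<open>H\<close> and
  \<open>p\<close> take the same values along corresponding sequences.\<close>

lemma limiting_subdiff_coisometry:
  assumes z: "z \<in> N"
  shows "limiting_subdiff H z = E ` limiting_subdiff p (P z)"
proof (intro set_eqI iffI)
  fix w
  assume "w \<in> limiting_subdiff H z"
  then obtain X V where fin: "\<bar>H z\<bar> \<noteq> \<infinity>" and V: "\<And>k. V k \<in> regular_subdiff H (X k)"
    and X: "X \<longlonglongrightarrow> z" and HX: "(\<lambda>k. H (X k)) \<longlonglongrightarrow> H z" and Vw: "V \<longlonglongrightarrow> w"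
    unfolding limiting_subdiff_def by auto
  \<comment> \<open>The regular formula holds inside \<open>N\<close> only, while a limiting
    sequence must consist of subgradients at every index; hence the shift by
    \<open>n\<close>.\<close>
  obtain n where n: "\<And>k. k \<ge> n \<Longrightarrow> X k \<in> N"
    using topological_tendstoD[OF X N z] unfolding eventually_sequentially by blast
  have reg: "V (k + n) \<in> E ` regular_subdiff p (P (X (k + n)))" for k
    using V[of "k + n"] regular_subdiff_coisometry[OF n] by simp
  have "(\<lambda>k. P (V (k + n))) \<longlonglongrightarrow> P w"
    by (intro P.tendsto LIMSEQ_ignore_initial_segment Vw)
  moreover have "(\<lambda>k. P (X (k + n))) \<longlonglongrightarrow> P z"
    by (intro P.tendsto LIMSEQ_ignore_initial_segment X)
  moreover have "(\<lambda>k. p (P (X (k + n)))) \<longlonglongrightarrow> p (P z)"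
    using LIMSEQ_ignore_initial_segment[OF HX, of n] H_eq n z by simp
  moreover have "P (V (k + n)) \<in> regular_subdiff p (P (X (k + n)))" for k
    using reg[of k] by auto
  moreover have "\<bar>p (P z)\<bar> \<noteq> \<infinity>" using fin H_eq z by simp
  ultimately have "P w \<in> limiting_subdiff p (P z)"
    unfolding limiting_subdiff_def mem_Collect_eq
    by (intro conjI exI[of _ "\<lambda>k. P (X (k + n))"] exI[of _ "\<lambda>k. P (V (k + n))"] allI)
  \<comment> \<open>Each vector in the range of \<open>E\<close> is fixed by the continuous map
    \<open>E \<circ> P\<close>, hence so is the limit.\<close>
  moreover have "w = E (P w)"
  proof (rule LIMSEQ_unique)
    show "(\<lambda>k. V (k + n)) \<longlonglongrightarrow> w" by (rule LIMSEQ_ignore_initial_segment[OF Vw])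
    have "(\<lambda>k. E (P (V (k + n)))) \<longlonglongrightarrow> E (P w)"
      by (intro E.tendsto P.tendsto LIMSEQ_ignore_initial_segment Vw)
    moreover have "E (P (V (k + n))) = V (k + n)" for k using reg[of k] by auto
    ultimately show "(\<lambda>k. V (k + n)) \<longlonglongrightarrow> E (P w)" by simp
  qed
  ultimately show "w \<in> E ` limiting_subdiff p (P z)" by blast
next
  fix w
  assume "w \<in> E ` limiting_subdiff p (P z)"
  then obtain v where w: "w = E v" and v: "v \<in> limiting_subdiff p (P z)" by blast
  from v obtain Y V where fin: "\<bar>p (P z)\<bar> \<noteq> \<infinity>"
    and V: "\<And>k. V k \<in> regular_subdiff p (Y k)"
    and Y: "Y \<longlonglongrightarrow> P z" and pY: "(\<lambda>k. p (Y k)) \<longlonglongrightarrow> p (P z)" and Vv: "V \<longlonglongrightarrow> v"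
    unfolding limiting_subdiff_def by auto
  define X where "X k = z + E (Y k - P z)" for k
  have PX: "P (X k) = Y k" for k unfolding X_def by (rule P_lift)
  have X: "X \<longlonglongrightarrow> z"
    unfolding X_def by (rule filterlim_compose[OF tendsto_lift Y])
  obtain n where n: "\<And>k. k \<ge> n \<Longrightarrow> X k \<in> N"
    using topological_tendstoD[OF X N z] unfolding eventually_sequentially by blast
  have "E (V (k + n)) \<in> regular_subdiff H (X (k + n))" for k
    using V[of "k + n"] regular_subdiff_coisometry[OF n] PX by simp
  moreover have "(\<lambda>k. X (k + n)) \<longlonglongrightarrow> z" by (rule LIMSEQ_ignore_initial_segment[OF X])
  moreover have "(\<lambda>k. H (X (k + n))) \<longlonglongrightarrow> H z"
    using LIMSEQ_ignore_initial_segment[OF pY, of n] H_eq n z PX by simp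
  moreover have "(\<lambda>k. E (V (k + n))) \<longlonglongrightarrow> w"
    unfolding w by (intro E.tendsto LIMSEQ_ignore_initial_segment Vv)
  moreover have "\<bar>H z\<bar> \<noteq> \<infinity>" using fin H_eq z by simp
  ultimately show "w \<in> limiting_subdiff H z"
    unfolding limiting_subdiff_def mem_Collect_eq
    by (intro conjI exI[of _ "\<lambda>k. X (k + n)"] exI[of _ "\<lambda>k. E (V (k + n))"] allI)
qed

lemma ext_dist_coisometry: "ext_dist 0 (E ` S) = ext_dist 0 S"
  by (simp add: ext_dist_def image_image)

text \<open>Values and distances to the subdifferentials agree on both sides, so
  \<open>\<eta>\<close> and \<open>c\<close> carry over and only \<open>\<delta>\<close> shrinks to
  stay in \<open>N\<close>. Properness is assumed for each function because it is global, whereas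
  \<open>H_eq\<close> is local.\<close>

lemma KL_property_coisometry:
  assumes z: "z \<in> N" and "proper H" "proper p"
  shows "KL_property H q z \<longleftrightarrow> KL_property p q (P z)"
proof -
  obtain d where d: "d > 0" "cball z d \<subseteq> N"
    using N z open_contains_cball by blast
  have inN: "x \<in> N" if "norm (x - z) \<le> min \<delta> d" for x \<delta>
    using that d(2) by (auto simp: dist_norm norm_minus_commute)
  \<comment> \<open>\<open>a\<close> is the value gap and \<open>S\<close> the distance;
    \<open>deriv\<close> stays unevaluated, since both sides feed it the same gap.\<close>
  let ?K = "\<lambda>c a (S::ereal). 1 \<le> ereal (deriv (\<lambda>t::real. c * t powr (1 - q)) (real_of_ereal a)) * S"
  have "(\<exists>\<delta>>0. \<exists>\<eta>::ereal. \<eta> > 0 \<and> (\<exists>c>0. \<forall>x.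
          norm (x - z) \<le> \<delta> \<and> H z < H x \<and> H x < H z + \<eta> \<longrightarrow>
          ?K c (H x - H z) (ext_dist 0 (limiting_subdiff H x)))) \<longleftrightarrow>
        (\<exists>\<delta>>0. \<exists>\<eta>::ereal. \<eta> > 0 \<and> (\<exists>c>0. \<forall>y.
          norm (y - P z) \<le> \<delta> \<and> p (P z) < p y \<and> p y < p (P z) + \<eta> \<longrightarrow>
          ?K c (p y - p (P z)) (ext_dist 0 (limiting_subdiff p y))))"
    (is "?L \<longleftrightarrow> ?R")
  proof
    assume ?L
    then obtain \<delta> \<eta> c where *: "\<delta> > 0" "\<eta> > 0" "c > 0"
      and K: "\<And>x. norm (x - z) \<le> \<delta> \<Longrightarrow> H z < H x \<Longrightarrow> H x < H z + \<eta> \<Longrightarrow>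
          ?K c (H x - H z) (ext_dist 0 (limiting_subdiff H x))"
      by blast
    have "?K c (p y - p (P z)) (ext_dist 0 (limiting_subdiff p y))"
      if y: "norm (y - P z) \<le> min \<delta> d" "p (P z) < p y" "p y < p (P z) + \<eta>" for y
    proof -
      \<comment> \<open>A point \<open>y\<close> is tested through its lift, which is as far from
        \<open>z\<close> as \<open>y\<close> is from \<open>P z\<close>.\<close>
      have "norm (z + E (y - P z) - z) \<le> min \<delta> d" using y by simp
      then show ?thesis
        using K[of "z + E (y - P z)"] y inN[of "z + E (y - P z)" \<delta>] H_eq z
          limiting_subdiff_coisometry P_lift[of z y]
        by (simp add: ext_dist_coisometry)
    qed
    moreover have "min \<delta> d > 0" using * d by simp
    ultimately show ?R using * by blast
  next
    assume ?R
    then obtain \<delta> \<eta> c where *: "\<delta> > 0" "\<eta> > 0" "c > 0"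
      and K: "\<And>y. norm (y - P z) \<le> \<delta> \<Longrightarrow> p (P z) < p y \<Longrightarrow> p y < p (P z) + \<eta> \<Longrightarrow>
          ?K c (p y - p (P z)) (ext_dist 0 (limiting_subdiff p y))"
      by blast
    have "?K c (H x - H z) (ext_dist 0 (limiting_subdiff H x))"
      if x: "norm (x - z) \<le> min \<delta> d" "H z < H x" "H x < H z + \<eta>" for x
    proof -
      have "norm (P x - P z) \<le> \<delta>"
        using norm_P_le[of "x - z"] x by (simp add: P.diff)
      then show ?thesis
        using K[of "P x"] x inN[of x \<delta>] H_eq z limiting_subdiff_coisometry
        by (simp add: ext_dist_coisometry)
    qed
    moreover have "min \<delta> d > 0" using * d by simp
    ultimately show ?L using * by blast
  qed
  then show ?thesis
    unfolding KL_property_def using assms limiting_subdiff_coisometry[OF z] by simp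
qed

end

end

section \<open>The iterates\<close>

text \<open>The Riesz representer of \<open>D\<close> is \<open>adjoint D 1\<close>; uniqueness of
  derivatives identifies it with the definite description.\<close>

lemma gradient_inner:
  fixes u :: "'a::euclidean_space \<Rightarrow> real"
  assumes "(u has_derivative D) (at x)"
  shows "gradient u x \<bullet> h = D h"
proof -
  have lin: "linear D" using assms by (rule has_derivative_linear)
  have eq: "D h = h \<bullet> adjoint D 1" for h using adjoint_works[OF lin, of h 1] by simp
  have "GDERIV u x :> adjoint D 1"
    unfolding gderiv_def using assms by (rule has_derivative_eq_rhs) (auto simp: eq inner_commute)
  moreover have "d = adjoint D 1" if "GDERIV u x :> d" for d
  proof -
    have "(\<lambda>h. h \<bullet> d) = D"
      using that assms unfolding gderiv_def by (rule has_derivative_unique)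
    then show ?thesis using eq by (metis vector_eq_ldot)
  qed
  ultimately have "gradient u x = adjoint D 1"
    unfolding gradient_def by (rule the_equality)
  then show ?thesis by (simp add: eq inner_commute)
qed

text \<open>A locally Lipschitz derivative is continuous on \<open>ball x e \<inter> S\<close>, and
  openness of \<open>S\<close> turns this into continuity at \<open>x\<close>.\<close>

lemma C11_on_isCont_derivative:
  assumes "C11_on S u" "open S"
  obtains u' where "\<And>x. x \<in> S \<Longrightarrow> (u has_derivative blinfun_apply (u' x)) (at x)"
    "\<And>x. x \<in> S \<Longrightarrow> isCont u' x"
proof -
  obtain u' where u': "\<And>x. x \<in> S \<Longrightarrow> (u has_derivative blinfun_apply (u' x)) (at x)"
    and lip: "\<And>x. x \<in> S \<Longrightarrow> \<exists>e>0. \<exists>K. K-lipschitz_on (ball x e \<inter> S) u'"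
    using assms(1) unfolding C11_on_def by blast
  have "isCont u' x" if x: "x \<in> S" for x
  proof -
    obtain e K where e: "e > 0" and K: "K-lipschitz_on (ball x e \<inter> S) u'" using lip[OF x] by blast
    have "continuous_on (ball x e \<inter> S) u'" using K by (rule lipschitz_on_continuous_on)
    then show ?thesis
      using e x assms(2) by (simp add: continuous_on_eq_continuous_at open_Int)
  qed
  with u' show ?thesis by (rule that)
qed

text \<open>Comparing \<open>xb\<close> with the midpoint of \<open>xb\<close> and \<open>xk\<close>, which is feasible, avoids
  differentiating the strongly convex model.\<close>

lemma mba_model_growth:
  fixes xk xb :: "real^'n" and g :: "real^'n \<Rightarrow> real^'m"
  assumes min: "is_arg_min (mba_model f \<phi> \<psi> xk \<xi> Q) (\<lambda>x. mba_G g x xk L \<le> 0) xb"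
    and phi: "convex_on UNIV \<phi>"
    and Q: "selfadjoint_between \<mu> \<mu>' Q"
    and g: "g xk \<le> 0" "g differentiable (at xk)"
    and L: "\<And>i. 0 \<le> L $ i"
  shows "\<mu> / 4 * (norm (xb - xk))\<^sup>2 \<le> mba_model f \<phi> \<psi> xk \<xi> Q xk - mba_model f \<phi> \<psi> xk \<xi> Q xb"
proof -
  define d where "d = xb - xk"
  define m where "m = xk + (1/2) *\<^sub>R d"
  have m: "m - xk = (1/2) *\<^sub>R d" and xb: "xb - xk = d" by (simp_all add: m_def d_def)
  have lin: "linear (frechet_derivative g (at xk))"
    using g(2) by (rule linear_frechet_derivative)
  have linQ: "linear Q" and lower: "\<mu> * (d \<bullet> d) \<le> d \<bullet> Q d"
    using Q unfolding selfadjoint_between_def by auto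
  have feas: "mba_G g xb xk L \<le> 0"
    and le: "\<And>y. mba_G g y xk L \<le> 0 \<Longrightarrow>
      mba_model f \<phi> \<psi> xk \<xi> Q xb \<le> mba_model f \<phi> \<psi> xk \<xi> Q y"
    using min unfolding is_arg_min_def by (auto simp: not_less)
  \<comment> \<open>\<open>mba_G\<close> is quadratic in its first variable, so its midpoint value
    is the average of the endpoint values, both nonpositive, minus a nonnegative multiple of
    \<open>L\<close>.\<close>
  have "mba_G g m xk L \<le> 0"
    unfolding less_eq_vec_def
  proof
    fix i
    have 1: "g xk $ i \<le> 0" and 2: "mba_G g xb xk L $ i \<le> 0"
      using g(1) feas unfolding less_eq_vec_def by auto
    have "0 \<le> (norm d)\<^sup>2 * L $ i" using L[of i] by simp
    moreover have "mba_G g m xk L $ i =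
        (g xk $ i + mba_G g xb xk L $ i) / 2 - (norm d)\<^sup>2 * L $ i / 8"
      unfolding mba_G_def m xb linear_scale[OF lin]
      by (simp add: field_simps power2_eq_square)
    ultimately show "mba_G g m xk L $ i \<le> (0::real^'m) $ i" using 1 2 by simp
  qed
  then have le_m: "mba_model f \<phi> \<psi> xk \<xi> Q xb \<le> mba_model f \<phi> \<psi> xk \<xi> Q m" by (rule le)
  have "m = (1 - 1/2) *\<^sub>R xk + (1/2) *\<^sub>R xb"
    by (simp add: m_def d_def algebra_simps flip: scaleR_left_distrib)
  then have "\<phi> m \<le> (1 - 1/2) * \<phi> xk + 1/2 * \<phi> xb"
    using convex_onD[OF phi, of "1/2" xk xb] by simp
  \<comment> \<open>At the midpoint the quadratic model lies below the average of its endpoint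
    values by at least \<open>d \<bullet> Q d / 8\<close>. Minimality of \<open>xb\<close> doubles
    this to a quarter.\<close>
  then have "d \<bullet> Q d / 4 \<le> mba_model f \<phi> \<psi> xk \<xi> Q xk - mba_model f \<phi> \<psi> xk \<xi> Q xb"
    using le_m unfolding mba_model_def mba_theta_def m xb
    by (simp add: linear_scale[OF linQ] linear_0[OF linQ] field_simps)
  then show ?thesis using lower by (simp add: xb power2_norm_eq_inner)
qed

text \<open>Sufficient decrease drives the accepted steps to zero. Model growth, together with the
  tolerance \<open>\<beta>F\<close>, then bounds the distance from the exact subproblem solution to
  the iterate by terms vanishing along the subsequence. Positivity of the limiting \<open>L\<close>
  is inherited from \<open>Lmin\<close>.\<close>

lemma inexact_MBA_cluster_point:
  fixes f :: "real^'n \<Rightarrow> ereal" and \<phi> \<psi> :: "real^'n \<Rightarrow> real"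
    and g :: "real^'n \<Rightarrow> real^'m" and U :: "(real^'n) set"
  assumes dc: "dc_program f \<phi> \<psi> g U"
    and run: "inexact_MBA f \<phi> \<psi> g \<mu>min \<mu>max Lmin Lmax M \<beta>R \<beta>F \<alpha> \<tau> x \<xi> \<mu> L Q xbar y v lam jk"
    and clu: "(xs, ss, Ls, \<xi>s) \<in> cluster_points (\<lambda>k. (xbar k (jk k), x k, L k (jk k), \<xi> k))"
  shows "xs = ss" "0 < Ls $ i"
proof -
  have C11g: "C11_on UNIV g" and opU: "open U" and GU: "g -` {..0} \<subseteq> U"
    and finU: "\<And>u. u \<in> U \<Longrightarrow> \<bar>f u\<bar> \<noteq> \<infinity>" and C11f: "C11_on U (\<lambda>x. real_of_ereal (f x))"
    and phi: "convex_on UNIV \<phi>" and bdd: "(INF x\<in>g -` {..0}. objective f \<phi> \<psi> g x) > -\<infinity>"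
    using dc unfolding dc_program_def by auto
  have pos: "0 < \<mu>min" "0 < Lmin" "0 < \<alpha>" "1 < \<tau>" and x0: "g (x 0) \<le> 0"
    and init: "\<And>k. \<mu> k 0 \<ge> \<mu>min" "\<And>k i. L k 0 $ i \<ge> Lmin"
    and Q: "\<And>k j. j \<le> jk k \<Longrightarrow> selfadjoint_between (\<mu> k j) (\<mu> k j + M) (Q k j)"
    and trial: "\<And>k j. j \<le> jk k \<Longrightarrow> mba_trial f \<phi> \<psi> g \<beta>R \<beta>F (x k) (\<xi> k) (Q k j) (L k j)
             (xbar k j) (y k j) (v k j) (lam k j)"
    and upd: "\<And>k j. j < jk k \<Longrightarrow> (if \<not> g (y k j) \<le> 0
            then L k (Suc j) = \<tau> *\<^sub>R L k j \<and> \<mu> k (Suc j) = \<mu> k j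
            else L k (Suc j) = L k j \<and> \<mu> k (Suc j) = \<tau> * \<mu> k j)"
    and feas: "\<And>k. g (y k (jk k)) \<le> 0"
    and desc: "\<And>k. mba_descent f \<phi> \<psi> g \<alpha> (x k) (y k (jk k))"
    and step: "\<And>k. x (Suc k) = y k (jk k)"
    using run unfolding inexact_MBA_def by auto
  \<comment> \<open>Backtracking only multiplies by \<open>\<tau> > 1\<close>, so the initial lower
    bounds persist.\<close>
  have low: "\<mu>min \<le> \<mu> k j \<and> (\<forall>i. Lmin \<le> L k j $ i)" if "j \<le> jk k" for k j
    using that
  proof (induction j)
    case 0
    then show ?case using init by simp
  next
    case (Suc j)
    have up: "a \<le> \<tau> * b" if "a \<le> b" "0 < a" for a b
      using that pos(4) mult_mono[of 1 \<tau> a b] by simp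
    show ?case using Suc upd[of j k] pos up by (auto split: if_splits)
  qed
  have xfeas: "g (x k) \<le> 0" for k
    by (cases k) (use x0 feas step in auto)
  have xU: "x k \<in> U" for k using xfeas GU by auto

  \<comment> \<open>The real-valued objective: at feasible iterates the indicator vanishes and
    \<open>f\<close> is finite because they lie in \<open>U\<close>.\<close>
  define ob where "ob u = real_of_ereal (f u) + \<phi> u - \<psi> u" for u
  have ob: "objective f \<phi> \<psi> g (x k) = ereal (ob (x k))" for k
    using xfeas[of k] finU[OF xU[of k]] unfolding objective_def ob_def ind_def
    by (cases "f (x k)") auto
  obtain B where B: "ereal B < (INF x\<in>g -` {..0}. objective f \<phi> \<psi> g x)"
    using ereal_dense2[OF bdd] by blast
  have obB: "B \<le> ob (x k)" for k
  proof -
    have "(INF x\<in>g -` {..0}. objective f \<phi> \<psi> g x) \<le> objective f \<phi> \<psi> g (x k)"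
      using xfeas by (intro INF_lower) auto
    with B have "ereal B \<le> ereal (ob (x k))" unfolding ob by (rule less_imp_le[OF less_le_trans])
    then show ?thesis by simp
  qed
  define dl where "dl k = norm (y k (jk k) - x k)" for k
  have dec: "ob (x (Suc k)) \<le> ob (x k) - \<alpha> / 2 * (dl k)\<^sup>2" for k
    using desc[of k] ob[of k] ob[of "Suc k"] unfolding mba_descent_def step[symmetric] dl_def by simp
  have "decseq (\<lambda>k. ob (x k))"
  proof (rule decseq_SucI)
    fix k
    have "0 \<le> \<alpha> / 2 * (dl k)\<^sup>2" using pos by simp
    then show "ob (x (Suc k)) \<le> ob (x k)" using dec[of k] by linarith
  qed
  then obtain l where l: "(\<lambda>k. ob (x k)) \<longlonglongrightarrow> l"
    using decseq_convergent obB by blast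
  \<comment> \<open>The squared steps are dominated by successive differences of a convergent
    sequence.\<close>
  have dl0: "dl \<longlonglongrightarrow> 0"
  proof -
    have "(\<lambda>k. 2 / \<alpha> * (ob (x k) - ob (x (Suc k)))) \<longlonglongrightarrow> 2 / \<alpha> * (l - l)"
      by (intro tendsto_intros l LIMSEQ_Suc)
    then have lim: "(\<lambda>k. 2 / \<alpha> * (ob (x k) - ob (x (Suc k)))) \<longlonglongrightarrow> 0" by simp
    have "(dl k)\<^sup>2 \<le> 2 / \<alpha> * (ob (x k) - ob (x (Suc k)))" for k
      using dec[of k] pos by (simp add: field_simps)
    then have "(\<lambda>k. (dl k)\<^sup>2) \<longlonglongrightarrow> 0"
      by (intro tendsto_sandwich[OF _ _ tendsto_const lim]) auto
    from tendsto_real_sqrt[OF this] show ?thesis by (simp add: dl_def[abs_def])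
  qed

  obtain g' where g': "\<And>u. (g has_derivative blinfun_apply (g' u)) (at u)"
    using C11_on_isCont_derivative[OF C11g open_UNIV] by (metis UNIV_I)
  have gdiff: "g differentiable (at u)" for u using g' unfolding differentiable_def by blast
  obtain f' where f': "\<And>u. u \<in> U \<Longrightarrow> ((\<lambda>x. real_of_ereal (f x)) has_derivative blinfun_apply (f' u)) (at u)"
    and f'_cont: "\<And>u. u \<in> U \<Longrightarrow> isCont f' u"
    using C11_on_isCont_derivative[OF C11f opU] by blast

  \<comment> \<open>The model gap between \<open>x k\<close> and its exact minimizer splits at the
    accepted point: the second piece is at most the \<open>\<beta>F\<close> tolerance, the first is
    estimated through the size of the step.\<close>
  have key: "\<mu>min / 4 * (norm (xbar k (jk k) - x k))\<^sup>2 \<le>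
      (norm (f' (x k)) + norm (\<xi> k)) * dl k + (\<phi> (x k) - \<phi> (y k (jk k))) + \<beta>F / 2 * (dl k)\<^sup>2" for k
  proof -
    define F where "F = mba_model f \<phi> \<psi> (x k) (\<xi> k) (Q k (jk k))"
    define d where "d = y k (jk k) - x k"
    have t: "is_arg_min F (\<lambda>u. mba_G g u (x k) (L k (jk k)) \<le> 0) (xbar k (jk k))"
      "F (y k (jk k)) - F (xbar k (jk k)) \<le> \<beta>F / 2 * (dl k)\<^sup>2"
      using trial[of "jk k" k] unfolding mba_trial_def F_def dl_def by auto
    have Qk: "linear (Q k (jk k))" "\<mu> k (jk k) * (d \<bullet> d) \<le> d \<bullet> Q k (jk k) d"
      using Q[of "jk k" k] unfolding selfadjoint_between_def by auto
    have "\<mu>min / 4 * (norm (xbar k (jk k) - x k))\<^sup>2 \<le> \<mu> k (jk k) / 4 * (norm (xbar k (jk k) - x k))\<^sup>2"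
      using low[of "jk k" k] by (intro mult_right_mono) auto
    also have "\<dots> \<le> F (x k) - F (xbar k (jk k))"
      unfolding F_def
      using low[of "jk k" k] pos
      by (intro mba_model_growth[OF t(1)[unfolded F_def] phi Q xfeas gdiff])
        (auto intro: order_trans[OF less_imp_le])
    also have "\<dots> \<le> (F (x k) - F (y k (jk k))) + \<beta>F / 2 * (dl k)\<^sup>2" using t(2) by simp
    also have "F (x k) - F (y k (jk k)) \<le>
        (norm (f' (x k)) + norm (\<xi> k)) * dl k + (\<phi> (x k) - \<phi> (y k (jk k)))"
    proof -
      have "F (x k) - F (y k (jk k)) = - (f' (x k) d + \<xi> k \<bullet> d) - (d \<bullet> Q k (jk k) d) / 2
          + (\<phi> (x k) - \<phi> (y k (jk k)))"
        unfolding F_def mba_model_def mba_theta_def d_def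
        by (simp add: inner_add_left gradient_inner[OF f'[OF xU]] linear_0[OF Qk(1)])
      moreover have "0 \<le> d \<bullet> Q k (jk k) d"
      proof -
        have "0 \<le> \<mu> k (jk k)" using low[of "jk k" k] pos by auto
        then have "0 \<le> \<mu> k (jk k) * (d \<bullet> d)" by simp
        then show ?thesis using Qk(2) by linarith
      qed
      moreover have "- f' (x k) d \<le> norm (f' (x k)) * dl k"
        using norm_blinfun[of "f' (x k)" d] by (simp add: dl_def d_def)
      moreover have "- (\<xi> k \<bullet> d) \<le> norm (\<xi> k) * dl k"
        using Cauchy_Schwarz_ineq2[of "\<xi> k" d] by (simp add: dl_def d_def)
      ultimately show ?thesis by (simp add: algebra_simps)
    qed
    finally show ?thesis by simp
  qed

  obtain r where r: "strict_mono r"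
    and lim: "((\<lambda>k. (xbar k (jk k), x k, L k (jk k), \<xi> k)) \<circ> r) \<longlonglongrightarrow> (xs, ss, Ls, \<xi>s)"
    using clu unfolding cluster_points_def by blast
  have lims: "(\<lambda>k. xbar (r k) (jk (r k))) \<longlonglongrightarrow> xs" "(\<lambda>k. x (r k)) \<longlonglongrightarrow> ss"
      "(\<lambda>k. L (r k) (jk (r k))) \<longlonglongrightarrow> Ls" "(\<lambda>k. \<xi> (r k)) \<longlonglongrightarrow> \<xi>s"
    using tendsto_fst[OF lim] tendsto_fst[OF tendsto_snd[OF lim]]
      tendsto_fst[OF tendsto_snd[OF tendsto_snd[OF lim]]]
      tendsto_snd[OF tendsto_snd[OF tendsto_snd[OF lim]]]
    by (simp_all add: o_def)
  have "Lmin \<le> Ls $ i"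
    by (rule LIMSEQ_le_const[OF tendsto_vec_nth[OF lims(3)]]) (use low in auto)
  then show "0 < Ls $ i" using pos by simp
  have dlr: "(\<lambda>k. dl (r k)) \<longlonglongrightarrow> 0"
    using LIMSEQ_subseq_LIMSEQ[OF dl0 r] by (simp add: o_def)
  have gc: "isCont g ss" using g' has_derivative_continuous by blast
  \<comment> \<open>The feasible set is closed, so \<open>ss\<close> lies in it and therefore in
    \<open>U\<close>, where \<open>f'\<close> is continuous.\<close>
  have "g ss \<le> 0"
    unfolding less_eq_vec_def
  proof
    fix i
    have "(\<lambda>k. g (x (r k)) $ i) \<longlonglongrightarrow> g ss $ i"
      by (intro tendsto_vec_nth isCont_tendsto_compose[OF gc] lims)
    then show "g ss $ i \<le> 0 $ i"
      by (rule LIMSEQ_le_const2) (use xfeas in \<open>auto simp: less_eq_vec_def\<close>)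
  qed
  then have ssU: "ss \<in> U" using GU by auto
  have "(\<lambda>k. y (r k) (jk (r k)) - x (r k)) \<longlonglongrightarrow> 0"
    using dlr unfolding dl_def by (rule tendsto_norm_zero_cancel)
  from tendsto_add[OF this lims(2)]
  have yl: "(\<lambda>k. y (r k) (jk (r k))) \<longlonglongrightarrow> ss" by simp
  have phic: "isCont \<phi> ss"
    using convex_on_continuous[OF open_UNIV phi] by (simp add: continuous_on_eq_continuous_at)
  \<comment> \<open>The factor of \<open>dl\<close> converges because \<open>\<xi>s\<close> is part
    of the cluster point, and the difference of \<phi> values vanishes because the accepted points
    also converge to \<open>ss\<close>.\<close>
  have ub: "(\<lambda>k. (norm (f' (x (r k))) + norm (\<xi> (r k))) * dl (r k)
      + (\<phi> (x (r k)) - \<phi> (y (r k) (jk (r k)))) + \<beta>F / 2 * (dl (r k))\<^sup>2)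
    \<longlonglongrightarrow> (norm (f' ss) + norm \<xi>s) * 0 + (\<phi> ss - \<phi> ss) + \<beta>F / 2 * 0\<^sup>2"
    by (intro tendsto_intros isCont_tendsto_compose[OF f'_cont[OF ssU]]
        isCont_tendsto_compose[OF phic] lims dlr yl)
  have lb: "(\<lambda>k. \<mu>min / 4 * (norm (xbar (r k) (jk (r k)) - x (r k)))\<^sup>2)
      \<longlonglongrightarrow> \<mu>min / 4 * (norm (xs - ss))\<^sup>2"
    by (intro tendsto_intros lims)
  have "\<mu>min / 4 * (norm (xs - ss))\<^sup>2 \<le>
      (norm (f' ss) + norm \<xi>s) * 0 + (\<phi> ss - \<phi> ss) + \<beta>F / 2 * 0\<^sup>2"
    by (rule LIMSEQ_le[OF lb ub]) (use key in auto)
  then show "xs = ss" using pos by (simp add: mult_le_0_iff)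
qed

section \<open>The cluster point is strictly feasible\<close>

text \<open>For \<open>y\<close> in the orthant, the inner product with \<open>y - w\<close> is just
  \<open>y $ i\<close>, which is nonpositive; constant sequences then pass from the regular to the
  limiting cone.\<close>

lemma axis_in_limiting_normal_cone_orthant:
  fixes w :: "real^'m"
  assumes "w \<le> 0" "w $ i = 0"
  shows "axis i 1 \<in> limiting_normal_cone {..0} w"
proof -
  have "\<forall>\<^sub>F y in at w within {..0}.
      ereal (axis i 1 \<bullet> (y - w) / norm (y - w)) \<le> 0"
    using assms(2)
    by (auto simp: eventually_at_filter inner_axis' less_eq_vec_def divide_nonpos_nonneg)
  then have "axis i 1 \<in> regular_normal_cone {..0} w"
    using assms(1) unfolding regular_normal_cone_def by (auto intro: Limsup_bounded)
  then show ?thesis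
    using assms(1) unfolding limiting_normal_cone_def mem_Collect_eq
    by (intro conjI exI[of _ "\<lambda>_. w"] exI[of _ "\<lambda>_. axis i 1"]) auto
qed

text \<open>Every normal vector \<open>l\<close> gives the kernel element \<open>(- A l, l)\<close>,
  so the condition forces the normal cone to be trivial, and an active index would contribute a
  nonzero normal.\<close>

lemma kernel_condition_imp_neg:
  fixes A :: "real^'m \<Rightarrow> 'a::real_vector"
  assumes "{(a, l). a + A l = 0} \<inter> (UNIV \<times> limiting_normal_cone {..0} w) = {(0, 0)}"
  shows "w $ i < 0"
proof -
  \<comment> \<open>The normal cone is empty outside the orthant, so the presence of the zero pair
    already gives \<open>w \<le> 0\<close>.\<close>
  have "(0, 0) \<in> {(a, l). a + A l = 0} \<inter> (UNIV \<times> limiting_normal_cone {..0} w)"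
    unfolding assms by simp
  then have w: "w \<le> 0" by (auto simp: limiting_normal_cone_def)
  have "w $ i \<noteq> 0"
  proof
    assume "w $ i = 0"
    then have "(- A (axis i 1), axis i 1) \<in>
        {(a, l). a + A l = 0} \<inter> (UNIV \<times> limiting_normal_cone {..0} w)"
      using axis_in_limiting_normal_cone_orthant[OF w] by auto
    then show False unfolding assms by (auto simp: axis_eq_0_iff)
  qed
  then show ?thesis using w by (simp add: less_eq_vec_def order_less_le)
qed

text \<open>Finitely many strict inequalities between continuous functions; joint continuity of
  \<open>mba_G\<close> in all its variables rests on continuity of the derivative of
  \<open>g\<close> in \<open>s\<close>.\<close>

lemma open_strictly_feasible:
  fixes g :: "real^'n \<Rightarrow> real^'m"
  assumes "C11_on UNIV g"
  shows "open {(x, s, L, \<xi> :: real^'n). \<forall>i. 0 < L $ i \<and> mba_G g x s L $ i < 0}"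
proof -
  obtain g' where g': "\<And>u. (g has_derivative blinfun_apply (g' u)) (at u)"
    and cont: "\<And>u. isCont g' u"
    using C11_on_isCont_derivative[OF assms open_UNIV] by (metis UNIV_I)
  have gc: "continuous_on UNIV g"
    using g' by (intro has_derivative_continuous_on[of UNIV g]) auto
  have g'c: "continuous_on UNIV g'"
    using cont by (auto simp: continuous_on_eq_continuous_at)
  have eq: "mba_G g x s L = g s + blinfun_apply (g' s) (x - s) + ((norm (x - s))\<^sup>2 / 2) *\<^sub>R L" for x s L
    unfolding mba_G_def frechet_derivative_at[OF g', symmetric] ..
  have "{(x, s, L, \<xi> :: real^'n). \<forall>i. 0 < L $ i \<and> mba_G g x s L $ i < 0} =
     (\<Inter>i. {z. 0 < fst (snd (snd z)) $ i} \<inter>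
       {z. mba_G g (fst z) (fst (snd z)) (fst (snd (snd z))) $ i < 0})"
    by auto
  moreover have "open \<dots>"
    unfolding eq
    by (intro open_INT finite_UNIV ballI open_Int open_Collect_less continuous_intros
        continuous_on_compose2[OF gc] continuous_on_compose2[OF g'c]) auto
  ultimately show ?thesis by simp
qed

section \<open>Transfer of the KL property between the two functions\<close>

lemma conjugate_neq_MInf: "conjugate \<psi> \<zeta> \<noteq> -\<infinity>"
proof -
  have "ereal (\<zeta> \<bullet> 0 - \<psi> 0) \<le> conjugate \<psi> \<zeta>"
    unfolding conjugate_def by (rule SUP_upper) simp
  then show ?thesis by auto
qed

theorem proposition9:
  fixes f :: "real^'n \<Rightarrow> ereal" and \<phi> \<psi> :: "real^'n \<Rightarrow> real"
    and g :: "real^'n \<Rightarrow> real^'m" and U :: "(real^'n) set"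
    and xs ss \<xi>s :: "real^'n" and Ls :: "real^'m" and q :: real
  assumes "dc_program f \<phi> \<psi> g U"
    and "inexact_MBA f \<phi> \<psi> g \<mu>min \<mu>max Lmin Lmax M \<beta>R \<beta>F \<alpha> \<tau> x \<xi> \<mu> L Q xbar y v lam jk"
    and "(xs, ss, Ls, \<xi>s) \<in> cluster_points (\<lambda>k. (xbar k (jk k), x k, L k (jk k), \<xi> k))"
    and "C2_at g xs"
    and "1 / 2 \<le> q" "q < 1"
    and "KL_property (mba_h f \<phi> \<psi>) q (xs, g xs, \<xi>s)"
    and "{(a, l). a + nabla g xs l = 0} \<inter> (UNIV \<times> limiting_normal_cone {..0} (g xs)) = {(0, 0)}"
  shows "KL_property (mba_Phi f \<phi> \<psi> g) q (xs, ss, Ls, \<xi>s)"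
proof -
  have ss: "xs = ss" and Ls: "\<And>i. 0 < Ls $ i"
    using inexact_MBA_cluster_point[OF assms(1-3)] by auto
  have neg: "\<And>i. g xs $ i < 0" using assms(8) by (rule kernel_condition_imp_neg)
  have C11g: "C11_on UNIV g" and propf: "proper f" using assms(1) unfolding dc_program_def by auto
  obtain g' where "\<And>u. (g has_derivative blinfun_apply (g' u)) (at u)"
    using C11_on_isCont_derivative[OF C11g open_UNIV] by (metis UNIV_I)
  then have "linear (frechet_derivative g (at xs))"
    by (intro linear_frechet_derivative) (auto simp: differentiable_def)
  \<comment> \<open>At coinciding arguments the linear and quadratic terms vanish.\<close>
  then have Gs: "mba_G g xs ss Ls = g xs" by (simp add: mba_G_def ss linear_0)

  \<comment> \<open>\<open>p\<close> is what both functions become once the indicators vanish.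
    \<open>N1\<close> and \<open>N2\<close> are the regions of strict feasibility, and
    \<open>P1\<close> and \<open>P2\<close> keep only \<open>x\<close> and
    \<open>\<xi>\<close>.\<close>
  define p where "p = (\<lambda>(x, \<xi>). f x + ereal (\<phi> x) + ereal (x \<bullet> \<xi>) + conjugate \<psi> (- \<xi>))"
  define N1 where "N1 = {(x, s, L, \<xi> :: real^'n). \<forall>i. 0 < L $ i \<and> mba_G g x s L $ i < 0}"
  define P1 where "P1 = (\<lambda>(x :: real^'n, s :: real^'n, L :: real^'m, \<xi> :: real^'n). (x, \<xi>))"
  define N2 where "N2 = {(x :: real^'n, w :: real^'m, \<xi> :: real^'n). \<forall>i. w $ i < 0}"
  define P2 where "P2 = (\<lambda>(x :: real^'n, w :: real^'m, \<xi> :: real^'n). (x, \<xi>))"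
  interpret Phi: coisometry P1 "\<lambda>(x, \<xi>). (x, 0, 0, \<xi>)"
    unfolding coisometry_def linear_conv_bounded_linear[symmetric] P1_def
    by (auto simp: inner_prod_def intro!: linearI)
  interpret h: coisometry P2 "\<lambda>(x, \<xi>). (x, 0, \<xi>)"
    unfolding coisometry_def linear_conv_bounded_linear[symmetric] P2_def
    by (auto simp: inner_prod_def intro!: linearI)
  have N1: "open N1" unfolding N1_def using C11g by (rule open_strictly_feasible)
  have N2: "open N2"
  proof -
    have "N2 = (\<Inter>i. {z. fst (snd z) $ i < 0})" unfolding N2_def by auto
    also have "open \<dots>"
      by (intro open_INT finite_UNIV ballI open_Collect_less continuous_intros) auto
    finally show ?thesis .
  qed
  have Phi_eq: "mba_Phi f \<phi> \<psi> g z = p (P1 z)" if "z \<in> N1" for z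
    using that unfolding N1_def P1_def p_def mba_Phi_def ind_def
    by (auto simp: less_eq_vec_def less_imp_le)
  have h_eq: "mba_h f \<phi> \<psi> z = p (P2 z)" if "z \<in> N2" for z
    using that unfolding N2_def P2_def p_def mba_h_def ind_def
    by (auto simp: less_eq_vec_def less_imp_le)
  have z1: "(xs, ss, Ls, \<xi>s) \<in> N1" using Ls neg by (simp add: N1_def Gs)
  have z2: "(xs, g xs, \<xi>s) \<in> N2" using neg by (simp add: N2_def)

  have proph: "proper (mba_h f \<phi> \<psi> :: _ \<times> (real^'m) \<times> _ \<Rightarrow> _)"
    using assms(7) by (simp add: KL_property_def)
  \<comment> \<open>The nonempty subdifferential in the KL hypothesis makes this value finite;
    through \<open>p\<close> it is also the finite value that makes \<Phi> proper.\<close>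
  have "\<bar>mba_h f \<phi> \<psi> (xs, g xs, \<xi>s)\<bar> \<noteq> \<infinity>"
    using assms(7) by (auto simp: KL_property_def limiting_subdiff_def)
  then have fin: "p (xs, \<xi>s) < \<infinity>" using h_eq[OF z2] by (auto simp: P2_def)
  have propp: "proper p"
    using propf conjugate_neq_MInf[of \<psi>] fin unfolding proper_def p_def by auto
  have "mba_Phi f \<phi> \<psi> g z \<noteq> -\<infinity>" for z
    using propf conjugate_neq_MInf[of \<psi>] unfolding proper_def mba_Phi_def ind_def
    by (auto split: prod.splits)
  moreover have "mba_Phi f \<phi> \<psi> g (xs, ss, Ls, \<xi>s) < \<infinity>"
    using fin Phi_eq[OF z1] by (simp add: P1_def)
  ultimately have propPhi: "proper (mba_Phi f \<phi> \<psi> g)" unfolding proper_def by blast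

  \<comment> \<open>The property descends from \<open>mba_h\<close> to \<open>p\<close> and then
    lifts to \<open>mba_Phi\<close>; both projections give the same point
    \<open>(xs, \<xi>s)\<close>.\<close>
  have "KL_property p q (P2 (xs, g xs, \<xi>s))"
    using h.KL_property_coisometry[OF N2 h_eq z2 proph propp] assms(7) by blast
  then have "KL_property p q (P1 (xs, ss, Ls, \<xi>s))" by (simp add: P1_def P2_def)
  then show ?thesis
    using Phi.KL_property_coisometry[OF N1 Phi_eq z1 propPhi propp] by blast
qed

end
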